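(* Consider, for a finite-dimensional evolution algebra $E$ over $\mathbb{C}$, the equivalence $$E\text{ is solvable}\iff E\text{ has no non-zero idempotents}.\qquad( * )$$ Then: every evolution algebra $E$ over $\mathbb{C}$ of dimension at most two satisfies $( * )$; and for every integer $n\ge 3$ there exists an $n$-dimensional evolution algebra over $\mathbb{C}$ for which $( * )$ fails.
   Context: An evolution algebra over a field $\mathbb{K}$ is a commutative, not necessarily associative, $\mathbb{K}$-algebra $E$ admitting a basis $\{e_1,\dots,e_n\}$ (called a natural basis) with $e_ie_j=0$ for all $i\ne j$. For subspaces $U,V$ of an algebra, $UV$ denotes the linear span of the products $uv$ with $u\in U$, $v\in V$. The derived series of an algebra $A$ is $A^{(1)}=A$, $A^{(m+1)}=A^{(m)}A^{(m)}$ for $m\ge1$; $A$ is solvable if $A^{(m)}=0$ for some $m$. An idempotent is an element $x$ with $x^2=x$. *)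

theory Defs
  imports Complex_Main "HOL-Library.Function_Algebras"
begin

(* A not necessarily associative algebra, carried by a linear subspace E of an ambient
   vector space. The multiplication is constrained on E only, and its values outside E are
   irrelevant. *)
locale nonassoc_algebra = vector_space scale
  for scale :: "'k::field \<Rightarrow> 'v::ab_group_add \<Rightarrow> 'v" (infixr "*s" 75) +
  fixes E :: "'v set"
    and mult :: "'v \<Rightarrow> 'v \<Rightarrow> 'v" (infixl "\<star>" 70)
  assumes subspace_carrier: "subspace E"
    and mult_closed: "x \<in> E \<Longrightarrow> y \<in> E \<Longrightarrow> x \<star> y \<in> E"
    and mult_add_left: "x \<in> E \<Longrightarrow> y \<in> E \<Longrightarrow> z \<in> E \<Longrightarrow> (x + y) \<star> z = x \<star> z + y \<star> z"
    and mult_add_right: "x \<in> E \<Longrightarrow> y \<in> E \<Longrightarrow> z \<in> E \<Longrightarrow> x \<star> (y + z) = x \<star> y + x \<star> z"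
    and mult_scale_left: "x \<in> E \<Longrightarrow> y \<in> E \<Longrightarrow> (c *s x) \<star> y = c *s (x \<star> y)"
    and mult_scale_right: "x \<in> E \<Longrightarrow> y \<in> E \<Longrightarrow> x \<star> (c *s y) = c *s (x \<star> y)"
begin

definition subspace_prod :: "'v set \<Rightarrow> 'v set \<Rightarrow> 'v set" where
  "subspace_prod U V = span {u \<star> v | u v. u \<in> U \<and> v \<in> V}"

(* The usual numbering starts at 1: derived_series m is the term with index m + 1. *)
primrec derived_series :: "nat \<Rightarrow> 'v set" where
  "derived_series 0 = E"
| "derived_series (Suc m) = subspace_prod (derived_series m) (derived_series m)"

definition solvable :: bool where
  "solvable \<longleftrightarrow> (\<exists>m. derived_series m = {0})"

definition idempotent :: "'v \<Rightarrow> bool" where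
  "idempotent x \<longleftrightarrow> x \<in> E \<and> x \<star> x = x"

definition natural_basis :: "'v set \<Rightarrow> bool" where
  "natural_basis B \<longleftrightarrow>
     finite B \<and> independent B \<and> span B = E \<and> (\<forall>x\<in>B. \<forall>y\<in>B. x \<noteq> y \<longrightarrow> x \<star> y = 0)"

end

(* Finite-dimensional, since a natural basis is finite; the zero algebra (empty basis) is included. *)
locale evolution_algebra = nonassoc_algebra +
  assumes mult_commute: "x \<in> E \<Longrightarrow> y \<in> E \<Longrightarrow> x \<star> y = y \<star> x"
    and ex_natural_basis: "\<exists>B. natural_basis B"

definition fun_scale :: "'k::field \<Rightarrow> ('i \<Rightarrow> 'k) \<Rightarrow> 'i \<Rightarrow> 'k" where
  "fun_scale c f = (\<lambda>i. c * f i)"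

end

theory Submission
  imports Defs "HOL-Computational_Algebra.Fundamental_Theorem_Algebra"
begin

text \<open>
  A non-zero idempotent lies in every term of the derived series. Conversely, let the dimension be
  two, with \<open>e\<^sub>1\<^sup>2 = a e\<^sub>1 + b e\<^sub>2\<close> and \<open>e\<^sub>2\<^sup>2 = c e\<^sub>1 + d e\<^sub>2\<close>. If \<open>ad = bc\<close>, then all products lie in
  one line, and either its generator squares to zero or a multiple of it is idempotent. If
  \<open>ad \<noteq> bc\<close>, then \<open>x (e\<^sub>1 + t e\<^sub>2)\<close> is idempotent for any root \<open>t\<close> of \<open>c t\<^sup>3 - d t\<^sup>2 + a t - b\<close>
  and \<open>x = 1 / (a + c t\<^sup>2)\<close>.

  In dimension at least three, take \<open>e\<^sub>0\<^sup>2 = 2 (e\<^sub>0 + e\<^sub>1)\<close>, \<open>e\<^sub>1\<^sup>2 = e\<^sub>1 + e\<^sub>2 = - e\<^sub>2\<^sup>2\<close>, and all other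
  squares zero. For \<open>u = e\<^sub>0 + e\<^sub>1\<close> and \<open>v = e\<^sub>1 + e\<^sub>2\<close> one has \<open>u\<^sup>2 = 2 u + v\<close>, \<open>u v = v\<close>, \<open>v\<^sup>2 = 0\<close>,
  so the span of \<open>u\<close> and \<open>v\<close> equals its own square. An idempotent is some \<open>p u + q v\<close>
  with \<open>p = 2 p\<^sup>2\<close> and \<open>q = p\<^sup>2 + 2 p q\<close>, which forces \<open>p = q = 0\<close>.
\<close>

section \<open>Derived series, idempotents and products in a general algebra\<close>

context nonassoc_algebra
begin

lemma mult_zero_left: "y \<in> E \<Longrightarrow> 0 \<star> y = 0"
  using mult_scale_left[of 0 y 0] subspace_0[OF subspace_carrier] by simp

lemma mult_zero_right: "x \<in> E \<Longrightarrow> x \<star> 0 = 0"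
  using mult_scale_right[of x 0 0] subspace_0[OF subspace_carrier] by simp

lemma subspace_prod_mono: "U \<subseteq> U' \<Longrightarrow> V \<subseteq> V' \<Longrightarrow> subspace_prod U V \<subseteq> subspace_prod U' V'"
  unfolding subspace_prod_def by (intro span_mono) blast

text \<open>By monotonicity of \<open>subspace_prod\<close>, such a set passes from each term to the
  next. As \<open>S\<close> may be any set, finitely many vectors suffice as a certificate of
  non-solvability.\<close>

lemma subset_derived_series:
  assumes "S \<subseteq> E" "S \<subseteq> subspace_prod S S"
  shows "S \<subseteq> derived_series m"
proof (induction m)
  case (Suc m)
  then show ?case
    using assms(2) subspace_prod_mono[OF Suc Suc] by simp
qed (use assms in simp)

lemma not_solvable_if_subset_subspace_prod:
  assumes "S \<subseteq> E" "S \<subseteq> subspace_prod S S" "x \<in> S" "x \<noteq> 0"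
  shows "\<not> solvable"
  using subset_derived_series[OF assms(1,2)] assms(3,4) unfolding solvable_def by blast

lemma not_solvable_if_idempotent:
  assumes "idempotent x" "x \<noteq> 0"
  shows "\<not> solvable"
proof (rule not_solvable_if_subset_subspace_prod)
  show "{x} \<subseteq> E" "{x} \<subseteq> subspace_prod {x} {x}"
    using assms(1) span_base[of x "{x}"] by (auto simp: idempotent_def subspace_prod_def)
qed (use assms in auto)

text \<open>Expanding both factors in the basis leaves only squares, since mixed products vanish.
  The expansion is a span induction in each factor.\<close>

lemma mult_in_span_squares:
  assumes B: "natural_basis B" and "x \<in> E" "y \<in> E"
  shows "x \<star> y \<in> span ((\<lambda>b. b \<star> b) ` B)"
proof -
  let ?T = "span ((\<lambda>b. b \<star> b) ` B)"
  have spB: "span B = E" and BE: "B \<subseteq> E"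
    and orth: "\<And>a b. a \<in> B \<Longrightarrow> b \<in> B \<Longrightarrow> a \<noteq> b \<Longrightarrow> a \<star> b = 0"
    using B span_superset[of B] by (auto simp: natural_basis_def)
  have basis: "a \<star> b \<in> ?T" if "a \<in> B" "b \<in> B" for a b
    using orth[OF that] that span_zero by (cases "a = b") (auto intro: span_base)
  have right: "a \<star> y \<in> ?T" if a: "a \<in> B" for a
  proof -
    \<comment> \<open>Membership in \<open>E\<close> is carried along because bilinearity is assumed
      on \<open>E\<close> only.\<close>
    have "subspace {y. y \<in> E \<and> a \<star> y \<in> ?T}"
      using subspace_carrier a BE mult_zero_right[of a] span_zero
      by (auto simp: subspace_def mult_add_right mult_scale_right subsetD
          intro!: span_add span_scale)
    then show ?thesis
      using span_induct[of y B "\<lambda>y. y \<in> E \<and> a \<star> y \<in> ?T"] basis a BE \<open>y \<in> E\<close> spB by blast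
  qed
  have "subspace {x. x \<in> E \<and> x \<star> y \<in> ?T}"
    using subspace_carrier \<open>y \<in> E\<close> mult_zero_left[of y] span_zero
    by (auto simp: subspace_def mult_add_left mult_scale_left intro!: span_add span_scale)
  then show ?thesis
    using span_induct[of x B "\<lambda>x. x \<in> E \<and> x \<star> y \<in> ?T"] right BE \<open>x \<in> E\<close> spB by blast
qed

lemma solvable_or_idempotent_if_products_in_line:
  assumes u: "u \<in> E" and line: "\<And>x y. x \<in> E \<Longrightarrow> y \<in> E \<Longrightarrow> x \<star> y \<in> span {u}"
  shows "solvable \<or> (\<exists>x. idempotent x \<and> x \<noteq> 0)"
proof -
  from line[OF u u] obtain k where k: "u \<star> u = k *s u"
    by (auto simp: span_singleton)
  show ?thesis
  proof (cases "k = 0 \<or> u = 0")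
    case True
    then have uu: "u \<star> u = 0"
      using k by auto
    have "derived_series 1 \<subseteq> span {u}"
      unfolding One_nat_def derived_series.simps subspace_prod_def
      using line by (intro span_minimal) auto
    moreover have "x \<star> y = 0" if "x \<in> span {u}" "y \<in> span {u}" for x y
      using that u subspace_scale[OF subspace_carrier] uu
      by (auto simp: span_singleton mult_scale_left mult_scale_right)
    ultimately have "{x \<star> y | x y. x \<in> derived_series 1 \<and> y \<in> derived_series 1} \<subseteq> {0}"
      by blast
    then have "derived_series (Suc 1) \<subseteq> span {0}"
      unfolding derived_series.simps(2)[of 1] subspace_prod_def by (rule span_mono)
    then have "derived_series (Suc 1) = {0}"
      using span_zero by (auto simp: subspace_prod_def)
    then show ?thesis
      unfolding solvable_def by blast
  next
    case False
    then have "idempotent (inverse k *s u)"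
      using u k subspace_scale[OF subspace_carrier]
      by (auto simp: idempotent_def mult_scale_left mult_scale_right)
    then show ?thesis
      using False by (intro disjI2 exI[of _ "inverse k *s u"]) auto
  qed
qed

lemma square_of_combination:
  assumes "e \<in> E" "f \<in> E" "e \<star> f = 0" "f \<star> e = 0"
  shows "(x *s e + y *s f) \<star> (x *s e + y *s f) = (x * x) *s (e \<star> e) + (y * y) *s (f \<star> f)"
  using assms subspace_scale[OF subspace_carrier] subspace_add[OF subspace_carrier]
  by (simp add: mult_add_left mult_add_right mult_scale_left mult_scale_right)

end

section \<open>Complex evolution algebras of dimension at most two\<close>

text \<open>With \<open>a, b\<close> and \<open>c, d\<close> the coordinates of the squares of
  \<open>e\<close> and \<open>f\<close>, this equation says that the square of
  \<open>e + t f\<close> is a multiple of \<open>e + t f\<close>.\<close>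

lemma ex_root_cubic:
  fixes a b c d :: complex
  assumes "a \<noteq> 0 \<or> c \<noteq> 0 \<or> d \<noteq> 0"
  shows "\<exists>t. t * (a + c * t\<^sup>2) = b + d * t\<^sup>2"
proof -
  have "\<not> constant (poly [:-b, a, -d, c:])"
    using assms by (auto simp: constant_degree)
  then obtain t where "poly [:-b, a, -d, c:] t = 0"
    using fundamental_theorem_of_algebra by blast
  then show ?thesis
    by (intro exI[of _ t]) (simp add: algebra_simps power2_eq_square)
qed

lemma solvable_or_idempotent_two_dim:
  fixes scale :: "complex \<Rightarrow> 'v::ab_group_add \<Rightarrow> 'v" and mult :: "'v \<Rightarrow> 'v \<Rightarrow> 'v"
  assumes "nonassoc_algebra scale E mult"
    and B: "nonassoc_algebra.natural_basis scale E mult {e, f}" and "e \<noteq> f"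
  shows "nonassoc_algebra.solvable scale E mult \<or>
    (\<exists>x. nonassoc_algebra.idempotent E mult x \<and> x \<noteq> 0)"
proof -
  interpret nonassoc_algebra scale E mult by fact
  have sp: "span {e, f} = E" and ind: "independent {e, f}"
    and orth: "mult e f = 0" "mult f e = 0"
    using B \<open>e \<noteq> f\<close> by (auto simp: natural_basis_def)
  have e: "e \<in> E" and f: "f \<in> E"
    unfolding sp[symmetric] by (auto intro: span_base)
  have coords: "\<exists>p q. x = scale p e + scale q f" if "x \<in> E" for x
    using that unfolding sp[symmetric]
    by (auto simp: span_insert span_singleton) (metis diff_eq_eq add.commute)
  obtain a b where ee: "mult e e = scale a e + scale b f"
    using coords mult_closed[OF e e] by blast
  obtain c d where ff: "mult f f = scale c e + scale d f"
    using coords mult_closed[OF f f] by blast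
  show ?thesis
  proof (cases "a * d = b * c")
    case True
    \<comment> \<open>The vanishing determinant makes the two squares proportional; \<open>u\<close>
      is the square of \<open>e\<close>, or that of \<open>f\<close> if the former is zero.\<close>
    have "\<exists>u\<in>E. mult e e \<in> span {u} \<and> mult f f \<in> span {u}"
    proof (cases "a = 0 \<and> b = 0")
      case True
      then show ?thesis
        using mult_closed[OF f f] ee span_zero
        by (intro bexI[of _ "mult f f"]) (auto intro: span_base)
    next
      case False
      have "\<exists>k. c = k * a \<and> d = k * b"
      proof (cases "a = 0")
        case True
        then show ?thesis
          using False \<open>a * d = b * c\<close> by (intro exI[of _ "d / b"]) auto
      next
        case False
        then show ?thesis
          using \<open>a * d = b * c\<close> by (intro exI[of _ "c / a"]) (auto simp: field_simps)
      qed
      then obtain k where "c = k * a" "d = k * b" by blast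
      then have "mult f f = scale k (mult e e)"
        by (simp add: ee ff scale_right_distrib)
      then show ?thesis
        using mult_closed[OF e e]
        by (intro bexI[of _ "mult e e"]) (auto intro: span_base span_scale)
    qed
    then obtain u where u: "u \<in> E" "mult e e \<in> span {u}" "mult f f \<in> span {u}"
      by blast
    then have "span ((\<lambda>b. mult b b) ` {e, f}) \<subseteq> span {u}"
      by (intro span_minimal) auto
    then show ?thesis
      using solvable_or_idempotent_if_products_in_line[OF u(1)] mult_in_span_squares[OF B] by blast
  next
    case False
    then have "a \<noteq> 0 \<or> c \<noteq> 0 \<or> d \<noteq> 0"
      by auto
    then obtain t where t: "t * (a + c * t\<^sup>2) = b + d * t\<^sup>2"
      using ex_root_cubic by blast
    define s where "s = a + c * t\<^sup>2"
    \<comment> \<open>Otherwise the root equation also gives \<open>b + d * t\<^sup>2 = 0\<close>,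
      and the rows of the coefficient matrix are proportional.\<close>
    have "s \<noteq> 0"
    proof
      assume "s = 0"
      then have "a = - (c * t\<^sup>2)" "b = - (d * t\<^sup>2)"
        using t by (auto simp: s_def eq_neg_iff_add_eq_0)
      then show False
        using False by simp
    qed
    \<comment> \<open>The square of \<open>e + t f\<close> is \<open>s\<close> times itself, so
      division by \<open>s\<close> yields an idempotent.\<close>
    define x where "x = scale (1 / s) e + scale (t / s) f"
    have "mult x x = scale (1 / s * (1 / s)) (mult e e) + scale (t / s * (t / s)) (mult f f)"
      unfolding x_def by (rule square_of_combination[OF e f orth])
    also have "\<dots> = scale ((a + c * t\<^sup>2) / s\<^sup>2) e + scale ((b + d * t\<^sup>2) / s\<^sup>2) f"
      by (simp add: ee ff scale_right_distrib scale_left_distrib add_divide_distrib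
          power2_eq_square algebra_simps)
    also have "\<dots> = x"
      unfolding t[symmetric] s_def[symmetric] x_def
      using \<open>s \<noteq> 0\<close> by (simp add: power2_eq_square)
    finally have "idempotent x"
      using e f subspace_scale[OF subspace_carrier] subspace_add[OF subspace_carrier]
      by (simp add: idempotent_def x_def)
    moreover have "x \<noteq> 0"
    proof
      assume "x = 0"
      then have "scale s (scale (1 / s) e + scale (t / s) f) = 0"
        by (simp add: x_def)
      then have "e = scale (- t) f"
        using \<open>s \<noteq> 0\<close> by (simp add: scale_right_distrib eq_neg_iff_add_eq_0)
      then have "e \<in> span {f}"
        using span_scale[OF span_base[of f "{f}"], of "- t"] by simp
      then show False
        using ind \<open>e \<noteq> f\<close> by (simp add: independent_insert)
    qed
    ultimately show ?thesis by blast
  qed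
qed

lemma solvable_iff_no_idempotent_dim_le_2:
  fixes scale :: "complex \<Rightarrow> 'v::ab_group_add \<Rightarrow> 'v" and mult :: "'v \<Rightarrow> 'v \<Rightarrow> 'v"
  assumes "evolution_algebra scale E mult" and dim: "vector_space.dim scale E \<le> 2"
  shows "nonassoc_algebra.solvable scale E mult \<longleftrightarrow>
    \<not> (\<exists>x. nonassoc_algebra.idempotent E mult x \<and> x \<noteq> 0)"
proof -
  interpret evolution_algebra scale E mult by fact
  have na: "nonassoc_algebra scale E mult" by unfold_locales
  obtain B where B: "natural_basis B"
    using ex_natural_basis by blast
  then have fin: "finite B" and sp: "span B = E" and "card B = dim E"
    using dim_span_eq_card_independent[of B] by (auto simp: natural_basis_def)
  then consider "card B = 0" | "card B = 1" | "card B = 2"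
    using dim by linarith
  then have "solvable \<or> (\<exists>x. idempotent x \<and> x \<noteq> 0)"
  proof cases
    case 1
    then have "derived_series 0 = {0}"
      using fin sp by simp
    then show ?thesis
      unfolding solvable_def by blast
  next
    case 2
    then obtain u where "B = {u}"
      by (auto simp: card_1_singleton_iff)
    then have "span {u} = E" "u \<in> E"
      using sp span_base[of u B] by auto
    then show ?thesis
      using solvable_or_idempotent_if_products_in_line[of u] mult_closed by simp
  next
    case 3
    then obtain e f where "B = {e, f}" "e \<noteq> f"
      by (auto simp: card_2_iff)
    then show ?thesis
      using solvable_or_idempotent_two_dim[OF na] B by blast
  qed
  then show ?thesis
    using not_solvable_if_idempotent by blast
qed

section \<open>The counterexample in dimension at least three\<close>

definition unit_fun :: "nat \<Rightarrow> nat \<Rightarrow> complex" where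
  "unit_fun j = (\<lambda>i. if i = j then 1 else 0)"

text \<open>A copy of complex \<open>n\<close>-space; all \<open>n\<close> share one ambient
  type.\<close>

definition fun_space :: "nat \<Rightarrow> (nat \<Rightarrow> complex) set" where
  "fun_space n = {f. \<forall>i\<ge>n. f i = 0}"

text \<open>The coordinates of the product fixed by the squares of \<open>e\<^sub>0\<close>,
  \<open>e\<^sub>1\<close>, \<open>e\<^sub>2\<close> given at the start; one formula serves every
  \<open>n\<close>.\<close>

definition counterexample_mult :: "(nat \<Rightarrow> complex) \<Rightarrow> (nat \<Rightarrow> complex) \<Rightarrow> nat \<Rightarrow> complex" where
  "counterexample_mult f g = (\<lambda>i.
     if i = 0 then 2 * f 0 * g 0
     else if i = 1 then 2 * f 0 * g 0 + f 1 * g 1 - f 2 * g 2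
     else if i = 2 then f 1 * g 1 - f 2 * g 2
     else 0)"

interpretation fun_vs: vector_space "fun_scale :: complex \<Rightarrow> (nat \<Rightarrow> complex) \<Rightarrow> nat \<Rightarrow> complex"
  by unfold_locales (auto simp: fun_scale_def fun_eq_iff algebra_simps)

lemma subspace_fun_space: "fun_vs.subspace (fun_space n)"
  by (auto simp: fun_vs.subspace_def fun_space_def fun_scale_def)

lemma inj_unit_fun: "inj unit_fun"
  by (rule injI) (metis unit_fun_def zero_neq_one)

text \<open>Both claims go through one induction, since the new vector is independent of the old
  ones by lying outside their span \<open>fun_space n\<close>.\<close>

lemma independent_span_unit_fun:
  "fun_vs.independent (unit_fun ` {..<n}) \<and> fun_vs.span (unit_fun ` {..<n}) = fun_space n"
proof (induction n)
  case 0
  show ?case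
    by (auto simp: fun_vs.independent_empty fun_space_def)
next
  case (Suc n)
  have img: "unit_fun ` {..<Suc n} = insert (unit_fun n) (unit_fun ` {..<n})"
    by (simp add: lessThan_Suc)
  have "unit_fun n \<notin> fun_space n"
    by (auto simp: fun_space_def unit_fun_def)
  then have ind: "fun_vs.independent (unit_fun ` {..<Suc n})"
    unfolding img using Suc by (simp add: fun_vs.independent_insert)
  have "(\<exists>k. f - fun_scale k (unit_fun n) \<in> fun_space n) \<longleftrightarrow> f \<in> fun_space (Suc n)" for f
  proof
    assume "\<exists>k. f - fun_scale k (unit_fun n) \<in> fun_space n"
    then obtain k where k: "\<And>i. i \<ge> n \<Longrightarrow> (f - fun_scale k (unit_fun n)) i = 0"
      by (auto simp: fun_space_def)
    show "f \<in> fun_space (Suc n)"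
      unfolding fun_space_def
    proof (intro CollectI allI impI)
      fix i assume "Suc n \<le> i"
      then show "f i = 0"
        using k[of i] by (simp add: fun_scale_def unit_fun_def)
    qed
  next
    assume "f \<in> fun_space (Suc n)"
    then have "f - fun_scale (f n) (unit_fun n) \<in> fun_space n"
      by (auto simp: fun_space_def fun_scale_def unit_fun_def)
    then show "\<exists>k. f - fun_scale k (unit_fun n) \<in> fun_space n" ..
  qed
  then have "fun_vs.span (unit_fun ` {..<Suc n}) = fun_space (Suc n)"
    unfolding img fun_vs.span_insert using Suc by auto
  with ind show ?case ..
qed

lemma dim_fun_space: "fun_vs.dim (fun_space n) = n"
proof -
  have "fun_vs.dim (fun_space n) = card (unit_fun ` {..<n})"
    using fun_vs.dim_span_eq_card_independent[of "unit_fun ` {..<n}"] independent_span_unit_fun[of n]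
    by simp
  then show ?thesis
    by (simp add: card_image inj_on_subset[OF inj_unit_fun])
qed

text \<open>Products are supported on the coordinates 0, 1, 2, so \<open>n \<ge> 3\<close> gives
  closure.\<close>

lemma nonassoc_algebra_counterexample:
  assumes "n \<ge> 3"
  shows "nonassoc_algebra fun_scale (fun_space n) counterexample_mult"
  by unfold_locales
    (use assms subspace_fun_space in
      \<open>auto simp: fun_scale_def fun_space_def counterexample_mult_def fun_eq_iff algebra_simps\<close>)

lemma evolution_algebra_counterexample:
  assumes "n \<ge> 3"
  shows "evolution_algebra fun_scale (fun_space n) counterexample_mult"
proof -
  interpret nonassoc_algebra fun_scale "fun_space n" counterexample_mult
    by (rule nonassoc_algebra_counterexample[OF assms])
  have "natural_basis (unit_fun ` {..<n})"
    using independent_span_unit_fun[of n]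
    by (auto simp: natural_basis_def counterexample_mult_def unit_fun_def fun_eq_iff)
  then show ?thesis
    by unfold_locales (auto simp: counterexample_mult_def algebra_simps)
qed

lemma not_solvable_counterexample:
  assumes "n \<ge> 3"
  shows "\<not> nonassoc_algebra.solvable fun_scale (fun_space n) counterexample_mult"
proof -
  interpret nonassoc_algebra fun_scale "fun_space n" counterexample_mult
    by (rule nonassoc_algebra_counterexample[OF assms])
  let ?u = "unit_fun 0 + unit_fun 1" and ?v = "unit_fun 1 + unit_fun 2"
  let ?P = "subspace_prod {?u, ?v} {?u, ?v}"
  have prod: "counterexample_mult x y \<in> ?P" if "x \<in> {?u, ?v}" "y \<in> {?u, ?v}" for x y
    unfolding subspace_prod_def by (rule fun_vs.span_base) (use that in blast)
  have "counterexample_mult ?u ?v = ?v"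
    by (auto simp: counterexample_mult_def unit_fun_def fun_eq_iff)
  then have v: "?v \<in> ?P"
    using prod[of ?u ?v] by simp
  \<comment> \<open>This is \<open>u\<^sup>2 = 2 u + v\<close> solved for \<open>u\<close>.\<close>
  have u_eq: "?u = fun_scale (1 / 2) (counterexample_mult ?u ?u - ?v)"
    by (auto simp: counterexample_mult_def unit_fun_def fun_scale_def fun_eq_iff)
  have u: "?u \<in> ?P"
    using fun_vs.span_scale[OF fun_vs.span_diff[OF prod[of ?u ?u, unfolded subspace_prod_def]
          v[unfolded subspace_prod_def]], of "1 / 2"]
    unfolding u_eq[symmetric] subspace_prod_def by simp
  show ?thesis
  proof (rule not_solvable_if_subset_subspace_prod)
    show "{?u, ?v} \<subseteq> fun_space n"
      using assms by (auto simp: fun_space_def unit_fun_def)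
    show "{?u, ?v} \<subseteq> ?P"
      using u v by blast
    show "?u \<noteq> 0"
      by (auto simp: unit_fun_def fun_eq_iff intro!: exI[of _ 0])
  qed simp
qed

text \<open>In terms of \<open>p u + q v\<close>, the coordinates are \<open>x 0 = p\<close>,
  \<open>x 1 = p + q\<close>, \<open>x 2 = q\<close>, and zero from index 3 on.\<close>

lemma idempotent_counterexample_eq_0:
  assumes "counterexample_mult x x = x"
  shows "x = 0"
proof -
  have c: "counterexample_mult x x i = x i" for i
    by (simp add: assms)
  have x0: "x 0 = 2 * x 0 * x 0" and x1: "x 1 = 2 * x 0 * x 0 + x 1 * x 1 - x 2 * x 2"
    and x2: "x 2 = x 1 * x 1 - x 2 * x 2"
    using c[of 0] c[of 1] c[of 2] by (simp_all add: counterexample_mult_def)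
  have high: "x i = 0" if "i \<ge> 3" for i
    using c[of i] that by (simp add: counterexample_mult_def)
  \<comment> \<open>The right-hand side of \<open>x1\<close> is the sum of those of
    \<open>x0\<close> and \<open>x2\<close>.\<close>
  have "x 1 = x 0 + x 2"
    using x0 x1 x2 by (metis add_diff_eq)
  then have sq: "x 2 = x 0 * x 0 + 2 * x 0 * x 2"
    using x2 by (simp add: algebra_simps)
  have "x 0 = 0"
  proof (rule ccontr)
    assume "x 0 \<noteq> 0"
    then have "2 * x 0 = 1"
      using x0 by simp
    \<comment> \<open>With \<open>2 * x 0 = 1\<close>, \<open>sq\<close> reads
      \<open>x 2 = x 0 * x 0 + x 2\<close>, so the square of \<open>x 0\<close> would
      vanish.\<close>
    then show False
      using sq \<open>x 0 \<noteq> 0\<close> by simp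
  qed
  then have "x 0 = 0" "x 1 = 0" "x 2 = 0"
    using sq \<open>x 1 = x 0 + x 2\<close> by auto
  moreover have "i = 0 \<or> i = 1 \<or> i = 2 \<or> i \<ge> 3" for i :: nat
    by auto
  ultimately show ?thesis
    using high by (metis ext zero_fun_apply)
qed

theorem corollary2p6:
  shows "(\<forall>(scale :: complex \<Rightarrow> 'v::ab_group_add \<Rightarrow> 'v) E mult.
            evolution_algebra scale E mult \<and> vector_space.dim scale E \<le> 2 \<longrightarrow>
              (nonassoc_algebra.solvable scale E mult \<longleftrightarrow>
                \<not> (\<exists>x. nonassoc_algebra.idempotent E mult x \<and> x \<noteq> 0)))
       \<and> (\<forall>n\<ge>3. \<exists>(E :: (nat \<Rightarrow> complex) set) mult.
            evolution_algebra fun_scale E mult \<and> vector_space.dim fun_scale E = n \<and>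
              \<not> (nonassoc_algebra.solvable fun_scale E mult \<longleftrightarrow>
                  \<not> (\<exists>x. nonassoc_algebra.idempotent E mult x \<and> x \<noteq> 0)))"
proof (intro conjI allI impI)
  fix scale :: "complex \<Rightarrow> 'v \<Rightarrow> 'v" and E mult
  assume "evolution_algebra scale E mult \<and> vector_space.dim scale E \<le> 2"
  then show "nonassoc_algebra.solvable scale E mult \<longleftrightarrow>
      \<not> (\<exists>x. nonassoc_algebra.idempotent E mult x \<and> x \<noteq> 0)"
    using solvable_iff_no_idempotent_dim_le_2 by blast
next
  fix n :: nat assume n: "3 \<le> n"
  \<comment> \<open>The equivalence fails from right to left: no non-zero idempotent, yet not
    solvable.\<close>
  have "x = 0" if "nonassoc_algebra.idempotent (fun_space n) counterexample_mult x" for x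
    using that idempotent_counterexample_eq_0
    by (simp add: nonassoc_algebra.idempotent_def[OF nonassoc_algebra_counterexample[OF n]])
  then show "\<exists>(E :: (nat \<Rightarrow> complex) set) mult.
      evolution_algebra fun_scale E mult \<and> vector_space.dim fun_scale E = n \<and>
        \<not> (nonassoc_algebra.solvable fun_scale E mult \<longleftrightarrow>
            \<not> (\<exists>x. nonassoc_algebra.idempotent E mult x \<and> x \<noteq> 0))"
    using evolution_algebra_counterexample[OF n] not_solvable_counterexample[OF n] dim_fun_space[of n]
    by blast
qed

end
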